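(* There is an absolute constant $C>0$ such that the following holds. Let an instance with $n$ jobs be given, and let $\tilde n$ be a number with $\beta n\le\tilde n\le\alpha n$ for some $\frac{1}{n}\le\beta\le 1$ and $\alpha\ge1$. Then the schedule $\mathcal{BAL}$ produced by $BAL(\tilde n^{2/3})$ satisfies \[ \sqrt{F(\mathcal{BAL})}\;\le\; C\, n^{1/3}\left(\beta^{-1/6}+\alpha^{1/3}\right)\sqrt{F(\mathcal{OPT})}; \] that is, the competitive ratio of $BAL(\tilde n^{2/3})$ for minimizing the $\ell_2$ norm of flow time is $O\!\left(n^{1/3}\left(\beta^{-1/6}+\alpha^{1/3}\right)\right)$.
   Context: Problem: a single machine and $n$ jobs $J_1,\dots,J_n$; job $J_i$ has an integer release time $r_i\ge 0$ and an integer processing time $p_i\ge 1$, revealed at time $r_i$ (online, clairvoyant). Time is divided into unit slots $[t]=[t,t+1)$, $t\in\mathbb{N}$. A (preemptive) schedule assigns to each slot at most one job, so that $J_i$ is assigned exactly $p_i$ slots, all with $t\ge r_i$. View $J_i$ as a chain of unit tasks $J_{i,1},\dots,J_{i,p_i}$: the $k$-th slot assigned to $J_i$ executes $J_{i,k}$; a task executed in slot $[t]$ completes at $t+1$. $c_i(\mathcal{S})$ is the completion time of $J_i$, $f_i(\mathcal{S})=c_i(\mathcal{S})-r_i$, $F(\mathcal{S})=\sum_i f_i(\mathcal{S})^2$; the $\ell_2$ norm of flow time is $\sqrt{F(\mathcal{S})}$, and $\mathcal{OPT}$ is a schedule minimizing $F$. $J_i$ is active at $t$ if $r_i\le t<c_i$;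 $q_t(i)$ is its number of remaining (not yet executed by time $t$) tasks under $BAL(\theta)$ if active, else $0$. SRPT: fix a schedule $\mathcal{SRPT}$ that in each slot executes an active job with the smallest remaining processing time (ties broken by a fixed rule); $M_{SRPT}(t)$ is the set of tasks executed in slots $[0],\dots,[t]$ under it. Algorithm $BAL(\theta)$: $M_{BAL}(t)$ is the set of tasks it executes in slots $[0],\dots,[t]$, $M_{BAL}(-1)=\varnothing$. Every job is initially normal. At each $t=0,1,2,\dots$: first, every active, not-yet-starving job $J_i$ with $(t-r_i)/q_t(i)\ge\theta$ becomes starving, recording $t_i=t$ and $\gamma_i=(t-r_i)/q_t(i)$ (it stays starving until completion). Then, if some active job is starving, slot $[t]$ executes the starving active job with smallest $t_i$, ties broken by largest $\gamma_i$, then smallest index. Otherwise, if $M_{SRPT}(t)\setminus M_{BAL}(t-1)\ne\varnothing$, slot $[t]$ executes, among the tasks in $M_{SRPT}(t)\setminus M_{BAL}(t-1)$, the one with the smallest completion time under $\mathcal{SRPT}$. *)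

theory Defs
  imports Complex_Main
begin

text \<open>The jobs of an instance are numbered \<open>0, \<dots>, njobs I - 1\<close>; only the values of
  \<open>release I\<close> and \<open>proc I\<close> on these indices are relevant.\<close>

record job_instance =
  njobs :: nat
  release :: "nat \<Rightarrow> nat"
  proc :: "nat \<Rightarrow> nat"

definition valid_instance :: "job_instance \<Rightarrow> bool" where
  "valid_instance I \<longleftrightarrow> (\<forall>i<njobs I. 1 \<le> proc I i)"

text \<open>A schedule maps the slot \<open>[t, t+1)\<close> to the job it is assigned to, if any.
  The task \<open>(i, k)\<close> is the \<open>k\<close>-th unit task of job \<open>i\<close>, where \<open>1 \<le> k \<le> proc I i\<close>.\<close>

type_synonym schedule = "nat \<Rightarrow> nat option"
type_synonym task = "nat \<times> nat"

definition feasible :: "job_instance \<Rightarrow> schedule \<Rightarrow> bool" where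
  "feasible I S \<longleftrightarrow>
     (\<forall>t i. S t = Some i \<longrightarrow> i < njobs I \<and> release I i \<le> t) \<and>
     (\<forall>i<njobs I. finite {t. S t = Some i} \<and> card {t. S t = Some i} = proc I i)"

definition completion :: "schedule \<Rightarrow> nat \<Rightarrow> nat" where
  "completion S i = Suc (Max {t. S t = Some i})"

definition flow_time :: "job_instance \<Rightarrow> schedule \<Rightarrow> nat \<Rightarrow> real" where
  "flow_time I S i = real (completion S i) - real (release I i)"

definition sq_flow :: "job_instance \<Rightarrow> schedule \<Rightarrow> real" where
  "sq_flow I S = (\<Sum>i<njobs I. (flow_time I S i)\<^sup>2)"

definition optimal :: "job_instance \<Rightarrow> schedule \<Rightarrow> bool" where
  "optimal I S \<longleftrightarrow> feasible I S \<and> (\<forall>S'. feasible I S' \<longrightarrow> sq_flow I S \<le> sq_flow I S')"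

definition executed :: "schedule \<Rightarrow> nat \<Rightarrow> nat \<Rightarrow> nat" where
  "executed S i t = card {s. s < t \<and> S s = Some i}"

definition task_at :: "schedule \<Rightarrow> nat \<Rightarrow> task option" where
  "task_at S t = map_option (\<lambda>i. (i, Suc (executed S i t))) (S t)"

text \<open>The set of tasks executed in the slots \<open>0, \<dots>, t\<close> (inclusive).\<close>

definition tasks_upto :: "schedule \<Rightarrow> nat \<Rightarrow> task set" where
  "tasks_upto S t = {\<tau>. \<exists>s\<le>t. task_at S s = Some \<tau>}"

definition task_completion :: "schedule \<Rightarrow> task \<Rightarrow> nat" where
  "task_completion S \<tau> = Suc (THE s. task_at S s = Some \<tau>)"

definition active :: "job_instance \<Rightarrow> schedule \<Rightarrow> nat \<Rightarrow> nat \<Rightarrow> bool" where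
  "active I S t i \<longleftrightarrow> i < njobs I \<and> release I i \<le> t \<and> t < completion S i"

text \<open>Every tie-breaking is allowed here, so quantifying over all schedules with this property
  covers every fixed tie-breaking rule.\<close>

definition srpt_schedule :: "job_instance \<Rightarrow> schedule \<Rightarrow> bool" where
  "srpt_schedule I S \<longleftrightarrow> feasible I S \<and>
     (\<forall>t. case S t of
        None \<Rightarrow> \<not> (\<exists>i. active I S t i)
      | Some i \<Rightarrow> active I S t i \<and>
          (\<forall>j. active I S t j \<longrightarrow> proc I i - executed S i t \<le> proc I j - executed S j t))"

text \<open>
  The algorithm \<open>BAL(\<theta>)\<close> is run step by step. Its state before slot \<open>t\<close> is the pair of
  the set \<open>M\<close> of tasks executed in the slots before \<open>t\<close>, and of a map \<open>\<sigma>\<close> with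
  \<open>\<sigma> i = Some (t\<^sub>i, \<gamma>\<^sub>i)\<close> if job \<open>i\<close> became starving at time \<open>t\<^sub>i < t\<close> with ratio \<open>\<gamma>\<^sub>i\<close>,
  and \<open>\<sigma> i = None\<close> if it is still normal. During the run a job is active iff it has been
  released and has unexecuted tasks; \<open>bal_active_iff\<close> below shows that this agrees with
  \<open>active\<close> for the resulting schedule.
\<close>

type_synonym bal_state = "task set \<times> (nat \<Rightarrow> (nat \<times> real) option)"

definition num_done :: "task set \<Rightarrow> nat \<Rightarrow> nat" where
  "num_done M i = card {k. (i, k) \<in> M}"

definition num_left :: "job_instance \<Rightarrow> task set \<Rightarrow> nat \<Rightarrow> nat" where
  "num_left I M i = proc I i - num_done M i"

definition bal_active :: "job_instance \<Rightarrow> nat \<Rightarrow> task set \<Rightarrow> nat \<Rightarrow> bool" where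
  "bal_active I t M i \<longleftrightarrow> i < njobs I \<and> release I i \<le> t \<and> 0 < num_left I M i"

definition mark_starving ::
  "job_instance \<Rightarrow> real \<Rightarrow> nat \<Rightarrow> bal_state \<Rightarrow> nat \<Rightarrow> (nat \<times> real) option" where
  "mark_starving I \<theta> t = (\<lambda>(M, \<sigma>) i.
     let \<gamma> = (real t - real (release I i)) / real (num_left I M i) in
     if bal_active I t M i \<and> \<sigma> i = None \<and> \<theta> \<le> \<gamma> then Some (t, \<gamma>) else \<sigma> i)"

definition starving_active ::
  "job_instance \<Rightarrow> nat \<Rightarrow> bal_state \<Rightarrow> nat \<Rightarrow> bool" where
  "starving_active I t = (\<lambda>(M, \<sigma>) i. bal_active I t M i \<and> \<sigma> i \<noteq> None)"

text \<open>Priority among starving jobs: smallest \<open>t\<^sub>i\<close>, then largest \<open>\<gamma>\<^sub>i\<close>, then smallest index.\<close>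

definition starving_before :: "(nat \<Rightarrow> (nat \<times> real) option) \<Rightarrow> nat \<Rightarrow> nat \<Rightarrow> bool" where
  "starving_before \<sigma> i j \<longleftrightarrow>
     (let (ti, \<gamma>i) = the (\<sigma> i); (tj, \<gamma>j) = the (\<sigma> j) in
      ti < tj \<or> ti = tj \<and> (\<gamma>i > \<gamma>j \<or> \<gamma>i = \<gamma>j \<and> i \<le> j))"

text \<open>The task executed in slot \<open>t\<close>; \<open>\<sigma>\<close> has already been updated for time \<open>t\<close>.\<close>

definition bal_choice ::
  "job_instance \<Rightarrow> schedule \<Rightarrow> nat \<Rightarrow> bal_state \<Rightarrow> task option" where
  "bal_choice I srpt t = (\<lambda>(M, \<sigma>).
     if \<exists>i. starving_active I t (M, \<sigma>) i then
       let i = (THE i. starving_active I t (M, \<sigma>) i \<and>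
                  (\<forall>j. starving_active I t (M, \<sigma>) j \<longrightarrow> starving_before \<sigma> i j))
       in Some (i, Suc (num_done M i))
     else if tasks_upto srpt t - M \<noteq> {} then
       Some (ARG_MIN (task_completion srpt) \<tau>. \<tau> \<in> tasks_upto srpt t - M)
     else None)"

fun bal_state :: "job_instance \<Rightarrow> real \<Rightarrow> schedule \<Rightarrow> nat \<Rightarrow> bal_state" where
  "bal_state I \<theta> srpt 0 = ({}, \<lambda>_. None)"
| "bal_state I \<theta> srpt (Suc t) =
     (let (M, \<sigma>) = bal_state I \<theta> srpt t;
          \<sigma>' = mark_starving I \<theta> t (M, \<sigma>)
      in (M \<union> set_option (bal_choice I srpt t (M, \<sigma>')), \<sigma>'))"

definition bal_task :: "job_instance \<Rightarrow> real \<Rightarrow> schedule \<Rightarrow> nat \<Rightarrow> task option" where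
  "bal_task I \<theta> srpt t =
     (let (M, \<sigma>) = bal_state I \<theta> srpt t
      in bal_choice I srpt t (M, mark_starving I \<theta> t (M, \<sigma>)))"

definition bal :: "job_instance \<Rightarrow> real \<Rightarrow> schedule \<Rightarrow> schedule" where
  "bal I \<theta> srpt t = map_option fst (bal_task I \<theta> srpt t)"


subsection \<open>The algorithm produces a feasible schedule\<close>

lemma executed_0 [simp]: "executed S i 0 = 0"
  by (simp add: executed_def)

lemma executed_Suc:
  "executed S i (Suc t) = executed S i t + (if S t = Some i then 1 else 0)"
proof -
  have "{s. s < Suc t \<and> S s = Some i} =
    (if S t = Some i then insert t {s. s < t \<and> S s = Some i} else {s. s < t \<and> S s = Some i})"
    by (auto simp: less_Suc_eq)
  then show ?thesis by (simp add: executed_def)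
qed

lemma executed_mono: "s \<le> t \<Longrightarrow> executed S i s \<le> executed S i t"
  unfolding executed_def by (rule card_mono) auto

lemma task_at_eq_Some:
  "task_at S t = Some (i, k) \<longleftrightarrow> S t = Some i \<and> k = Suc (executed S i t)"
  by (auto simp: task_at_def)

lemma task_at_exists:
  assumes "1 \<le> k" "k \<le> executed S i t"
  shows "\<exists>s<t. task_at S s = Some (i, k)"
  using assms
proof (induction t)
  case (Suc t)
  then show ?case
    by (cases "k \<le> executed S i t")
       (auto simp: executed_Suc task_at_eq_Some less_Suc_eq split: if_splits)
qed simp

lemma task_at_strict:
  assumes "task_at S s = Some (i, k)" "task_at S t = Some (i, l)" "s < t"
  shows "k < l"
  using assms executed_mono[of "Suc s" t S i]
  by (auto simp: task_at_eq_Some executed_Suc)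

lemma task_at_unique:
  assumes "task_at S s = Some \<tau>" "task_at S t = Some \<tau>"
  shows "s = t"
  using assms task_at_strict[of S s "fst \<tau>" "snd \<tau>" t "snd \<tau>"]
    task_at_strict[of S t "fst \<tau>" "snd \<tau>" s "snd \<tau>"]
  by (metis less_irrefl linorder_neqE_nat prod.collapse)

lemma task_completion_eq: "task_at S s = Some \<tau> \<Longrightarrow> task_completion S \<tau> = Suc s"
  unfolding task_completion_def by (metis (mono_tags, lifting) task_at_unique the_equality)

lemma executed_le_card:
  assumes "finite {t. S t = Some i}"
  shows "executed S i t \<le> card {t. S t = Some i}"
  unfolding executed_def by (rule card_mono) (use assms in auto)

lemma feasible_executed_le:
  assumes "feasible I S" "i < njobs I"
  shows "executed S i t \<le> proc I i"
  using executed_le_card[of S i t] assms by (simp add: feasible_def)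

lemma feasible_completion_iff:
  assumes "valid_instance I" "feasible I S" "i < njobs I"
  shows "t < completion S i \<longleftrightarrow> executed S i t < proc I i"
proof -
  let ?A = "{t. S t = Some i}"
  have fin: "finite ?A" and card: "card ?A = proc I i" and pos: "1 \<le> proc I i"
    using assms by (auto simp: feasible_def valid_instance_def)
  then have ne: "?A \<noteq> {}" by force
  have sub: "{s. s < t \<and> S s = Some i} \<subseteq> ?A" by auto
  show ?thesis
  proof
    assume "t < completion S i"
    then have "t \<le> Max ?A" by (simp add: completion_def)
    then have "Max ?A \<in> ?A - {s. s < t \<and> S s = Some i}" using Max_in[OF fin ne] by auto
    then have "{s. s < t \<and> S s = Some i} \<subset> ?A" using sub by blast
    then show "executed S i t < proc I i"
      using psubset_card_mono[OF fin] card by (auto simp: executed_def)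
  next
    assume lt: "executed S i t < proc I i"
    show "t < completion S i"
    proof (rule ccontr)
      assume "\<not> t < completion S i"
      then have "Max ?A < t" by (simp add: completion_def)
      then have "?A = {s. s < t \<and> S s = Some i}" using Max_ge[OF fin] by force
      then show False using lt card by (simp add: executed_def)
    qed
  qed
qed

lemma starving_first:
  assumes "finite A" "A \<noteq> {}"
  shows "\<exists>i\<in>A. \<forall>j\<in>A. starving_before \<sigma> i j"
  using assms
proof (induction rule: finite_ne_induct)
  case (singleton x)
  then show ?case by (auto simp: starving_before_def Let_def split: prod.splits)
next
  case (insert x A)
  then obtain i where i: "i \<in> A" "\<forall>j\<in>A. starving_before \<sigma> i j" by blast
  have tr: "starving_before \<sigma> a b \<Longrightarrow> starving_before \<sigma> b c \<Longrightarrow> starving_before \<sigma> a c" for a b c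
    by (auto simp: starving_before_def Let_def split: prod.splits)
  have tot: "starving_before \<sigma> i x \<or> starving_before \<sigma> x i" and rf: "starving_before \<sigma> x x"
    by (auto simp: starving_before_def Let_def split: prod.splits)
  show ?case using tot
  proof
    assume "starving_before \<sigma> i x"
    then show ?thesis using i by blast
  next
    assume "starving_before \<sigma> x i"
    then have "\<forall>j\<in>insert x A. starving_before \<sigma> x j" using i rf tr by blast
    then show ?thesis by blast
  qed
qed

lemma starving_choice:
  assumes "\<exists>i. starving_active I t (M, \<sigma>) i"
  shows "\<exists>!i. starving_active I t (M, \<sigma>) i \<and>
           (\<forall>j. starving_active I t (M, \<sigma>) j \<longrightarrow> starving_before \<sigma> i j)"
proof -
  let ?A = "{i. starving_active I t (M, \<sigma>) i}"
  have "?A \<subseteq> {..<njobs I}" by (auto simp: starving_active_def bal_active_def)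
  then have "finite ?A" using finite_subset by blast
  then obtain i where "i \<in> ?A" "\<forall>j\<in>?A. starving_before \<sigma> i j"
    using starving_first[of ?A \<sigma>] assms by blast
  moreover have "a = b" if "starving_before \<sigma> a b" "starving_before \<sigma> b a" for a b
    using that by (auto simp: starving_before_def Let_def split: prod.splits)
  ultimately show ?thesis by blast
qed

text \<open>The state of the algorithm agrees with the schedule, and each step executes the next
  task of a released job.\<close>

lemma bal_state_task:
  "fst (bal_state I \<theta> srpt (Suc t)) =
     fst (bal_state I \<theta> srpt t) \<union> set_option (bal_task I \<theta> srpt t)"
  by (simp add: bal_task_def Let_def split: prod.splits)

lemma bal_choice_next:
  assumes srpt: "feasible I srpt"
    and M: "\<And>i. {k. (i, k) \<in> M} = {1..e i}"
    and choice: "bal_choice I srpt t (M, \<sigma>) = Some (i, k)"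
  shows "i < njobs I \<and> release I i \<le> t \<and> k = Suc (e i) \<and> k \<le> proc I i"
proof (cases "\<exists>i. starving_active I t (M, \<sigma>) i")
  case True
  then have "starving_active I t (M, \<sigma>) i" "k = Suc (num_done M i)"
    using choice theI'[OF starving_choice[OF True]]
    by (auto simp: bal_choice_def Let_def)
  then show ?thesis
    using M[of i] by (auto simp: starving_active_def bal_active_def num_left_def num_done_def)
next
  case False
  let ?D = "tasks_upto srpt t - M"
  from False choice have ne: "?D \<noteq> {}" and
    am: "(i, k) = arg_min (task_completion srpt) (\<lambda>\<tau>. \<tau> \<in> ?D)"
    by (auto simp: bal_choice_def split: if_splits)
  from ne have "is_arg_min (task_completion srpt) (\<lambda>\<tau>. \<tau> \<in> ?D) (i, k)"
    unfolding am by (metis ex_in_conv is_arg_min_arg_min_nat)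
  then have D: "(i, k) \<in> ?D"
    and least: "\<And>\<tau>. \<tau> \<in> ?D \<Longrightarrow> task_completion srpt (i, k) \<le> task_completion srpt \<tau>"
    by (auto simp: is_arg_min_linorder)
  from D obtain s where s: "s \<le> t" "task_at srpt s = Some (i, k)"
    by (auto simp: tasks_upto_def)
  then have si: "srpt s = Some i" and k: "k = Suc (executed srpt i s)"
    by (auto simp: task_at_eq_Some)
  have i: "i < njobs I" "release I i \<le> t"
    using srpt si s(1) unfolding feasible_def by (auto intro: order_trans)
  have kp: "k \<le> proc I i"
    using feasible_executed_le[OF srpt i(1), of "Suc s"] si k by (simp add: executed_Suc)
  have "k \<notin> {1..e i}" using D M[of i] by blast
  then have ge: "Suc (e i) \<le> k" using k by auto
  have "k = Suc (e i)"
  proof (rule ccontr)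
    assume "k \<noteq> Suc (e i)"
    then have "Suc (e i) \<le> executed srpt i s" using ge k by simp
    then obtain s' where s': "s' < s" "task_at srpt s' = Some (i, Suc (e i))"
      using task_at_exists[of "Suc (e i)" srpt i s] by auto
    then have "(i, Suc (e i)) \<in> tasks_upto srpt t"
      using s(1) unfolding tasks_upto_def by (auto intro!: exI[of _ s'])
    moreover have "Suc (e i) \<notin> {k. (i, k) \<in> M}" unfolding M by simp
    then have "(i, Suc (e i)) \<notin> M" by simp
    ultimately have "task_completion srpt (i, k) \<le> task_completion srpt (i, Suc (e i))"
      using least by blast
    then show False using task_completion_eq[OF s(2)] task_completion_eq[OF s'(2)] s'(1) by simp
  qed
  then show ?thesis using i kp by simp
qed

lemma bal_state_executed:
  assumes "feasible I srpt"
  shows "{k. (i, k) \<in> fst (bal_state I \<theta> srpt t)} = {1..executed (bal I \<theta> srpt) i t}"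
proof (induction t arbitrary: i)
  case (Suc t)
  have next_task: "k = Suc (executed (bal I \<theta> srpt) j t)"
    if "bal_task I \<theta> srpt t = Some (j, k)" for j k
    using bal_choice_next[OF assms Suc, of t _ j k] that
    by (auto simp: bal_task_def Let_def split: prod.splits)
  have split: "{k. (i, k) \<in> fst (bal_state I \<theta> srpt (Suc t))} =
      {1..executed (bal I \<theta> srpt) i t} \<union> {k. bal_task I \<theta> srpt t = Some (i, k)}"
    unfolding bal_state_task Suc[symmetric] by (cases "bal_task I \<theta> srpt t") auto
  show ?case
  proof (cases "bal I \<theta> srpt t = Some i")
    case True
    then obtain k where "bal_task I \<theta> srpt t = Some (i, k)" by (auto simp: bal_def)
    moreover from this have "k = Suc (executed (bal I \<theta> srpt) i t)" by (rule next_task)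
    ultimately show ?thesis
      unfolding split using True by (auto simp del: bal_state.simps simp: executed_Suc)
  next
    case False
    have "bal_task I \<theta> srpt t \<noteq> Some (i, k)" for k
    proof
      assume "bal_task I \<theta> srpt t = Some (i, k)"
      with False show False by (simp add: bal_def)
    qed
    then show ?thesis
      unfolding split using False by (simp add: executed_Suc)
  qed
qed simp

lemma bal_task_next:
  assumes "feasible I srpt" "bal_task I \<theta> srpt t = Some (i, k)"
  shows "i < njobs I \<and> release I i \<le> t \<and> k = Suc (executed (bal I \<theta> srpt) i t) \<and> k \<le> proc I i"
proof -
  obtain M \<sigma> where st: "bal_state I \<theta> srpt t = (M, \<sigma>)" by fastforce
  show ?thesis
    by (rule bal_choice_next[OF assms(1), of M])
       (use assms(2) bal_state_executed[OF assms(1), of _ \<theta> t] st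
        in \<open>auto simp: bal_task_def Let_def\<close>)
qed

lemma task_at_bal:
  assumes "feasible I srpt"
  shows "task_at (bal I \<theta> srpt) t = bal_task I \<theta> srpt t"
proof (cases "bal_task I \<theta> srpt t")
  case None
  then show ?thesis by (simp add: task_at_def bal_def)
next
  case (Some a)
  then show ?thesis
    using bal_task_next[OF assms, of \<theta> t "fst a" "snd a"]
    by (auto simp: task_at_def bal_def prod_eq_iff)
qed

lemma bal_executed_le:
  assumes "feasible I srpt" "i < njobs I"
  shows "executed (bal I \<theta> srpt) i t \<le> proc I i"
proof (induction t)
  case (Suc t)
  show ?case
  proof (cases "bal I \<theta> srpt t = Some i")
    case True
    then obtain k where "bal_task I \<theta> srpt t = Some (i, k)" by (auto simp: bal_def)
    then show ?thesis using bal_task_next[OF assms(1)] True by (auto simp: executed_Suc)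
  qed (use Suc in \<open>simp add: executed_Suc\<close>)
qed simp

lemma bal_busy:
  assumes srpt: "feasible I srpt" and i: "i < njobs I"
    and late: "executed srpt i (Suc t) = proc I i"
    and left: "executed (bal I \<theta> srpt) i t < proc I i"
  shows "bal I \<theta> srpt t \<noteq> None"
proof -
  obtain M \<sigma> where st: "bal_state I \<theta> srpt t = (M, \<sigma>)" by fastforce
  let ?k = "Suc (executed (bal I \<theta> srpt) i t)"
  obtain s where s: "s < Suc t" "task_at srpt s = Some (i, ?k)"
    using task_at_exists[of ?k srpt i "Suc t"] late left by auto
  then have "(i, ?k) \<in> tasks_upto srpt t" by (auto simp: tasks_upto_def less_Suc_eq_le)
  moreover have "?k \<notin> {k. (i, k) \<in> M}"
    using bal_state_executed[OF srpt, of i \<theta> t] st by simp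
  ultimately have "tasks_upto srpt t - M \<noteq> {}" by blast
  then show ?thesis
    by (auto simp: bal_def bal_task_def st bal_choice_def Let_def)
qed

lemma bal_feasible:
  assumes srpt: "feasible I srpt"
  shows "feasible I (bal I \<theta> srpt)"
proof -
  let ?S = "bal I \<theta> srpt"
  have released: "i < njobs I \<and> release I i \<le> t" if "?S t = Some i" for t i
    using that bal_task_next[OF srpt, of \<theta> t i] by (auto simp: bal_def)
  have total: "(\<Sum>i<njobs I. executed ?S i t) \<ge> t - T"
    if busy: "\<And>t. t \<ge> T \<Longrightarrow> ?S t \<noteq> None" for t T
  proof (induction t)
    case (Suc t)
    have eq: "(\<Sum>i<njobs I. executed ?S i (Suc t)) =
      (\<Sum>i<njobs I. executed ?S i t) + (\<Sum>i<njobs I. if ?S t = Some i then 1 else 0)"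
      by (simp add: executed_Suc sum.distrib)
    show ?case
    proof (cases "T \<le> t")
      case True
      then obtain j where j: "?S t = Some j" using busy by blast
      then have "(\<Sum>i<njobs I. if ?S t = Some i then 1 else 0 :: nat) = 1"
        using released[OF j] by simp
      then show ?thesis using eq Suc True by simp
    qed (simp add: not_le)
  qed simp
  have "finite {t. ?S t = Some i} \<and> card {t. ?S t = Some i} = proc I i" if i: "i < njobs I" for i
  proof -
    have "\<exists>t. executed ?S i t = proc I i"
    proof (rule ccontr)
      assume "\<not> ?thesis"
      then have left: "executed ?S i t < proc I i" for t
        using bal_executed_le[OF srpt i, of \<theta> t] by (simp add: le_neq_implies_less)
      have A: "finite {t. srpt t = Some i}" "card {t. srpt t = Some i} = proc I i"
        using srpt i by (auto simp: feasible_def)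
      then obtain T where T: "\<forall>t\<in>{t. srpt t = Some i}. t < T"
        using finite_nat_set_iff_bounded by blast
      have "executed srpt i (Suc t) = proc I i" if "T \<le> t" for t
      proof -
        have "{s. s < Suc t \<and> srpt s = Some i} = {t. srpt t = Some i}" using T that by fastforce
        then show ?thesis using A by (simp add: executed_def)
      qed
      then have "?S t \<noteq> None" if "T \<le> t" for t
        using bal_busy[OF srpt i _ left] that by blast
      then have "(\<Sum>j<njobs I. executed ?S j t) \<ge> t - T" for t
        using total by blast
      moreover have "(\<Sum>j<njobs I. executed ?S j t) \<le> (\<Sum>j<njobs I. proc I j)" for t
        by (rule sum_mono) (use bal_executed_le[OF srpt] in auto)
      ultimately have "t - T \<le> (\<Sum>j<njobs I. proc I j)" for t
        using order_trans by blast
      from this[of "Suc (T + (\<Sum>j<njobs I. proc I j))"] show False by simp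
    qed
    then obtain t where t: "executed ?S i t = proc I i" by blast
    have "{s. ?S s = Some i} = {s. s < t \<and> ?S s = Some i}"
    proof -
      have "s < t" if "?S s = Some i" for s
      proof (rule ccontr)
        assume "\<not> s < t"
        then have "proc I i < executed ?S i (Suc s)"
          using executed_mono[of t s ?S i] t that by (simp add: executed_Suc)
        then show False using bal_executed_le[OF srpt i, of \<theta> "Suc s"] by simp
      qed
      then show ?thesis by blast
    qed
    then have "card {s. ?S s = Some i} = proc I i" using t by (simp add: executed_def)
    moreover have "finite {s. ?S s = Some i}"
      using \<open>{s. ?S s = Some i} = _\<close> by (metis finite_Collect_conjI finite_Collect_less_nat)
    ultimately show ?thesis by blast
  qed
  then show ?thesis using released by (auto simp: feasible_def)
qed

lemma bal_active_iff:
  assumes "valid_instance I" "feasible I srpt"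
  shows "bal_active I t (fst (bal_state I \<theta> srpt t)) i \<longleftrightarrow> active I (bal I \<theta> srpt) t i"
  using feasible_completion_iff[OF assms(1) bal_feasible[OF assms(2)], of i t \<theta>]
    bal_state_executed[OF assms(2), of i \<theta> t]
  by (auto simp: bal_active_def active_def num_left_def num_done_def)

end

theory Submission
  imports Defs "HOL-Analysis.Convex"
begin

text \<open>
  Let \<open>F\<close> be the optimal sum of squared flow times. The remaining work, summed over time, is at most
  \<open>\<Sum>\<^sub>i p\<^sub>i f\<^sub>i \<le> F\<close> for the optimum, hence also for BAL, which never has more work left than any
  other schedule. A job that waited for time \<open>w\<close> before starving with \<open>q\<close> units left has
  \<open>w \<le> 2 \<theta> q\<close> up to rounding and contributes at least \<open>w q\<close> to that sum, so the squared waiting times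
  add up to \<open>O(\<theta> F)\<close>.

  The remaining delay of a starving job is at most the total work \<open>W\<close> of the jobs starving with it,
  and \<open>W\<^sup>2 = O(F / \<surd>\<theta>)\<close>: SRPT minimizes the work outside the \<open>m\<close> longest jobs, while if every choice of
  \<open>m\<close> jobs leaves work \<open>D\<close> in the optimum, then \<open>m + 1\<close> jobs wait for \<open>D\<close> there and
  \<open>F \<ge> (m + 1) D\<^sup>2\<close>. What \<open>W\<close> exceeds \<open>D\<close> by is covered by the \<open>m\<close> excluded jobs, whose sizes \<open>q\<^sub>i\<close>
  at the start of starving satisfy \<open>\<theta> \<Sum> q\<^sub>i\<^sup>2 \<le> F\<close>. Taking \<open>m = \<surd>\<theta>\<close> gives
  \<open>F(BAL) = O(\<theta> + n / \<surd>\<theta>) F\<close>.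
\<close>

section \<open>Remaining work\<close>

definition remaining :: "job_instance \<Rightarrow> schedule \<Rightarrow> nat \<Rightarrow> nat \<Rightarrow> nat" where
  "remaining I S i t = proc I i - executed S i t"

definition released :: "job_instance \<Rightarrow> nat \<Rightarrow> nat set" where
  "released I t = {i. i < njobs I \<and> release I i \<le> t}"

lemma finite_released [simp]: "finite (released I t)"
  by (simp add: released_def)

lemma remaining_antimono: "s \<le> t \<Longrightarrow> remaining I S i t \<le> remaining I S i s"
  by (simp add: remaining_def diff_le_mono2 executed_mono)

lemma executed_before_release:
  assumes "feasible I S" "t \<le> release I i"
  shows "executed S i t = 0"
proof -
  have "{s. s < t \<and> S s = Some i} = {}"
    using assms by (force simp: feasible_def)
  then show ?thesis by (simp add: executed_def)
qed

lemma remaining_pos_iff: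
  assumes "valid_instance I" "feasible I S" "i < njobs I"
  shows "0 < remaining I S i t \<longleftrightarrow> t < completion S i"
  using feasible_completion_iff[OF assms] by (simp add: remaining_def)

lemma sum_slot_indicator:
  assumes "finite A"
  shows "(\<Sum>i\<in>A. if S t = Some i then 1 else 0) = (if \<exists>i\<in>A. S t = Some i then 1 else 0 :: nat)"
proof (cases "S t")
  case (Some j)
  then show ?thesis using assms by auto
qed simp

lemma sum_remaining_step:
  assumes "finite A"
  shows "(\<Sum>i\<in>A. remaining I S i t) \<le> (\<Sum>i\<in>A. remaining I S i (Suc t)) + 1"
proof -
  have "(\<Sum>i\<in>A. remaining I S i t) \<le>
      (\<Sum>i\<in>A. remaining I S i (Suc t) + (if S t = Some i then 1 else 0))"
    by (rule sum_mono) (auto simp: remaining_def executed_Suc)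
  also have "\<dots> \<le> (\<Sum>i\<in>A. remaining I S i (Suc t)) + 1"
    by (simp add: sum.distrib sum_slot_indicator[OF assms])
  finally show ?thesis .
qed

lemma sum_remaining_steps:
  assumes "finite A"
  shows "(\<Sum>i\<in>A. remaining I S i t) \<le> (\<Sum>i\<in>A. remaining I S i (t + d)) + d"
proof (induction d)
  case (Suc d)
  then show ?case using sum_remaining_step[OF assms, of I S "t + d"] by simp
qed simp

section \<open>Flow times bounded below by remaining work\<close>

lemma flow_time_ge:
  assumes "valid_instance I" "feasible I S" "i < njobs I" "release I i \<le> t"
    and "0 < remaining I S i t"
  shows "flow_time I S i \<ge> real (Suc t - release I i)"
  using remaining_pos_iff[OF assms(1-3), of t] assms(4,5) by (simp add: flow_time_def)

lemma release_less_completion: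
  assumes "valid_instance I" "feasible I S" "i < njobs I"
  shows "release I i < completion S i"
  using feasible_completion_iff[OF assms, of "release I i"] assms
    executed_before_release[OF assms(2), of "release I i" i]
  by (auto simp: valid_instance_def)

lemma proc_le_flow_time:
  assumes "valid_instance I" "feasible I S" "i < njobs I"
  shows "real (proc I i) \<le> flow_time I S i"
proof -
  let ?A = "{t. S t = Some i}"
  have fin: "finite ?A" and card: "card ?A = proc I i"
    using assms by (auto simp: feasible_def)
  have "?A \<subseteq> {release I i..<completion S i}"
    using assms fin by (auto simp: feasible_def completion_def less_Suc_eq_le)
  then have "proc I i \<le> completion S i - release I i"
    using card_mono[of "{release I i..<completion S i}" ?A] card by simp
  then show ?thesis
    using release_less_completion[OF assms] by (simp add: flow_time_def)
qed

text \<open>Between release and completion at most \<open>proc I i\<close> units are left in each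
  slot, and \<open>proc I i\<close> is itself at most the flow time.\<close>

lemma sum_remaining_le_flow:
  assumes "valid_instance I" "feasible I S" "i < njobs I"
  shows "real (\<Sum>t | t < T \<and> release I i \<le> t. remaining I S i t) \<le> (flow_time I S i)\<^sup>2"
proof -
  have "(\<Sum>t | t < T \<and> release I i \<le> t. remaining I S i t)
      = (\<Sum>t\<in>{t. t < T \<and> release I i \<le> t} \<inter> {..<completion S i}. remaining I S i t)"
    by (rule sum.mono_neutral_right) (use remaining_pos_iff[OF assms] in auto)
  also have "\<dots> \<le> (\<Sum>t\<in>{t. t < T \<and> release I i \<le> t} \<inter> {..<completion S i}. proc I i)"
    by (rule sum_mono) (simp add: remaining_def)
  also have "\<dots> \<le> (\<Sum>t\<in>{release I i..<completion S i}. proc I i)"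
    by (rule sum_mono2) auto
  finally have "real (\<Sum>t | t < T \<and> release I i \<le> t. remaining I S i t)
      \<le> real ((completion S i - release I i) * proc I i)"
    by (simp only: sum_constant card_atLeastLessThan of_nat_id of_nat_le_iff)
  also have "\<dots> = flow_time I S i * real (proc I i)"
    using release_less_completion[OF assms] by (simp add: flow_time_def of_nat_diff)
  also have "\<dots> \<le> (flow_time I S i)\<^sup>2"
    using proc_le_flow_time[OF assms] by (simp add: power2_eq_square mult_left_mono)
  finally show ?thesis .
qed

lemma sum_released_swap:
  "(\<Sum>t<T. \<Sum>i\<in>released I t. f i t) =
     (\<Sum>i<njobs I. \<Sum>t | t < T \<and> release I i \<le> t. f i t)"
  unfolding released_def
  using sum.swap_restrict[of "{..<T}" "{..<njobs I}" "\<lambda>t i. f i t" "\<lambda>t i. release I i \<le> t"]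
  by (simp add: lessThan_def)

lemma sum_remaining_le_sq_flow:
  assumes "valid_instance I" "feasible I S"
  shows "real (\<Sum>t<T. \<Sum>i\<in>released I t. remaining I S i t) \<le> sq_flow I S"
proof -
  have "real (\<Sum>t<T. \<Sum>i\<in>released I t. remaining I S i t)
      = (\<Sum>i<njobs I. real (\<Sum>t | t < T \<and> release I i \<le> t. remaining I S i t))"
    by (simp only: sum_released_swap of_nat_sum)
  also have "\<dots> \<le> sq_flow I S"
    unfolding sq_flow_def by (rule sum_mono) (use sum_remaining_le_flow[OF assms] in auto)
  finally show ?thesis .
qed

text \<open>At most one unit is processed per slot, so after \<open>D - 1\<close> further slots more than \<open>m\<close> of the
  jobs released by time \<open>t\<close> are still unfinished.\<close>

lemma sq_flow_ge_of_spread_work: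
  assumes "valid_instance I" "feasible I S"
    and spread: "\<And>X. finite X \<Longrightarrow> card X \<le> m \<Longrightarrow> D \<le> (\<Sum>i\<in>released I t - X. remaining I S i t)"
  shows "real (Suc m) * (real D)\<^sup>2 \<le> sq_flow I S"
proof (cases "D = 0")
  case True
  then show ?thesis by (simp add: sq_flow_def sum_nonneg)
next
  case False
  let ?u = "t + (D - 1)"
  define Z where "Z = {i \<in> released I t. 0 < remaining I S i ?u}"
  have fin: "finite Z" by (simp add: Z_def)
  have "m < card Z"
  proof (rule ccontr)
    assume "\<not> m < card Z"
    then have "D \<le> (\<Sum>i\<in>released I t - Z. remaining I S i t)" using spread fin by simp
    also have "\<dots> \<le> (\<Sum>i\<in>released I t - Z. remaining I S i ?u) + (D - 1)"
      by (rule sum_remaining_steps) simp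
    also have "(\<Sum>i\<in>released I t - Z. remaining I S i ?u) = 0" by (simp add: Z_def)
    finally show False using False by simp
  qed
  then have "real (Suc m) * (real D)\<^sup>2 \<le> real (card Z) * (real D)\<^sup>2"
    by (intro mult_right_mono) auto
  also have "\<dots> = (\<Sum>i\<in>Z. (real D)\<^sup>2)" by simp
  also have "\<dots> \<le> (\<Sum>i\<in>Z. (flow_time I S i)\<^sup>2)"
  proof (rule sum_mono)
    fix i assume "i \<in> Z"
    then have i: "i < njobs I" "release I i \<le> t" "0 < remaining I S i ?u"
      by (auto simp: Z_def released_def)
    then have "real (Suc ?u - release I i) \<le> flow_time I S i"
      by (intro flow_time_ge assms) auto
    \<comment> \<open>A job of \<open>Z\<close> is unfinished at the start of slot
      \<open>?u\<close>, so it completes at time \<open>t + D\<close> at the earliest.\<close>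
    moreover have "D \<le> Suc ?u - release I i" using False i(2) by simp
    ultimately have "real D \<le> flow_time I S i" by linarith
    then show "(real D)\<^sup>2 \<le> (flow_time I S i)\<^sup>2" by (simp add: power_mono)
  qed
  also have "\<dots> \<le> sq_flow I S"
    unfolding sq_flow_def by (rule sum_mono2) (auto simp: Z_def released_def)
  finally show ?thesis .
qed


section \<open>Dominance of SRPT\<close>

text \<open>SRPT works on a shortest unfinished job \<open>j\<close>. If \<open>j\<close> lies
  outside \<open>Y\<close>, the work outside \<open>Y\<close> loses a unit; otherwise
  \<open>j\<close> is traded for an unfinished job outside \<open>Y\<close>, which is at least as
  long. Truncated subtraction covers the case that no work is left outside \<open>Y\<close>.\<close>

lemma srpt_step:
  assumes srpt: "srpt_schedule I A" and val: "valid_instance I" and Y: "Y \<subseteq> released I t"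
  shows "\<exists>Y'\<subseteq>released I t. card Y' \<le> card Y \<and>
    (\<Sum>i\<in>released I t - Y'. remaining I A i (Suc t)) \<le> (\<Sum>i\<in>released I t - Y. remaining I A i t) - 1"
proof (cases "\<exists>i\<in>released I t - Y. 0 < remaining I A i t")
  case False
  then have zero: "remaining I A i t = 0" if "i \<in> released I t - Y" for i using that by (metis gr0I)
  then have "remaining I A i (Suc t) = 0" if "i \<in> released I t - Y" for i
    using that remaining_antimono[of t "Suc t" I A i] by simp
  then show ?thesis using Y by (intro exI[of _ Y]) simp
next
  case True
  then obtain i where i: "i \<in> released I t" "i \<notin> Y" "0 < remaining I A i t" by blast
  have feas: "feasible I A" using srpt by (simp add: srpt_schedule_def)
  have fin: "finite Y" using Y finite_subset by fastforce
  have "active I A t i"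
    using i remaining_pos_iff[OF val feas, of i t] by (simp add: active_def released_def)
  then obtain j where j: "A t = Some j" "active I A t j" "remaining I A j t \<le> remaining I A i t"
    using srpt by (fastforce simp: srpt_schedule_def remaining_def split: option.splits)
  have jr: "j \<in> released I t" "0 < remaining I A j t"
    using j(2) remaining_pos_iff[OF val feas, of j t] by (auto simp: active_def released_def)
  have dec: "(\<Sum>i\<in>B. remaining I A i (Suc t)) \<le> (\<Sum>i\<in>B. remaining I A i t) - 1"
    if "finite B" "j \<in> B" for B
  proof -
    have "(\<Sum>i\<in>B - {j}. remaining I A i (Suc t)) \<le> (\<Sum>i\<in>B - {j}. remaining I A i t)"
      by (rule sum_mono) (simp add: remaining_antimono)
    moreover have "remaining I A j (Suc t) = remaining I A j t - 1"
      using j(1) by (simp add: remaining_def executed_Suc)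
    ultimately show ?thesis using jr(2) that by (simp add: sum.remove)
  qed
  show ?thesis
  proof (cases "j \<in> Y")
    case False
    then show ?thesis using Y dec[of "released I t - Y"] jr by (intro exI[of _ Y]) simp
  next
    case True
    \<comment> \<open>exchange \<open>j\<close> for the longer job \<open>i\<close>\<close>
    let ?Y = "insert i (Y - {j})"
    define B where "B = released I t - Y - {i}"
    have eq: "released I t - ?Y = insert j B" "released I t - Y = insert i B"
      using i jr True by (auto simp: B_def)
    have B: "j \<notin> B" "i \<notin> B" "finite B" using True by (auto simp: B_def)
    have "(\<Sum>i\<in>insert j B. remaining I A i (Suc t)) \<le> (\<Sum>i\<in>insert j B. remaining I A i t) - 1"
      using B by (intro dec) auto
    moreover have "(\<Sum>i\<in>insert j B. remaining I A i t) \<le> (\<Sum>i\<in>insert i B. remaining I A i t)"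
      using B j(3) by simp
    ultimately have "(\<Sum>i\<in>released I t - ?Y. remaining I A i (Suc t))
        \<le> (\<Sum>i\<in>released I t - Y. remaining I A i t) - 1"
      unfolding eq by linarith
    moreover have "card ?Y \<le> card Y"
      using card.remove[OF fin True] fin i(2) by simp
    moreover have "?Y \<subseteq> released I t" using Y i by auto
    ultimately show ?thesis by blast
  qed
qed

text \<open>Written with minima, SRPT minimizes at each time and for each \<open>m\<close> the remaining work outside the
  \<open>m\<close> longest remaining jobs.\<close>

lemma srpt_dominates:
  assumes srpt: "srpt_schedule I A" and val: "valid_instance I" and feas: "feasible I S"
    and "finite X"
  shows "\<exists>Y\<subseteq>released I t. card Y \<le> card X \<and>
    (\<Sum>i\<in>released I t - Y. remaining I A i t) \<le> (\<Sum>i\<in>released I t - X. remaining I S i t)"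
  using \<open>finite X\<close>
proof (induction t arbitrary: X)
  case 0
  have "card (X \<inter> released I 0) \<le> card X" using 0 by (intro card_mono) auto
  moreover have "released I 0 - X \<inter> released I 0 = released I 0 - X" by blast
  ultimately show ?case
    by (intro exI[of _ "X \<inter> released I 0"]) (simp add: remaining_def)
next
  case (Suc t)
  have feasA: "feasible I A" using srpt by (simp add: srpt_schedule_def)
  let ?N = "released I (Suc t) - released I t"
  let ?X = "X \<inter> released I t"
  have diffX: "released I t - ?X = released I t - X" by blast
  obtain Y where Y: "Y \<subseteq> released I t" "card Y \<le> card ?X"
    "(\<Sum>i\<in>released I t - Y. remaining I A i t) \<le> (\<Sum>i\<in>released I t - X. remaining I S i t)"
    using Suc.IH[of ?X] Suc.prems unfolding diffX by auto
  obtain Y' where Y': "Y' \<subseteq> released I t" "card Y' \<le> card Y"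
    "(\<Sum>i\<in>released I t - Y'. remaining I A i (Suc t)) \<le> (\<Sum>i\<in>released I t - Y. remaining I A i t) - 1"
    using srpt_step[OF srpt val Y(1)] by blast
  \<comment> \<open>Jobs released at time \<open>Suc t\<close> are untouched in both schedules, so
    those in \<open>X\<close> can be excluded on both sides. On the older jobs \<open>S\<close>
    gains at most one unit in slot \<open>t\<close>, and \<open>srpt_step\<close> compensates for
    it.\<close>
  let ?Y = "Y' \<union> (X \<inter> ?N)"
  have new: "remaining I A i (Suc t) = remaining I S i (Suc t)" if "i \<in> ?N" for i
  proof -
    from that have "Suc t \<le> release I i" by (auto simp: released_def)
    then show ?thesis
      using executed_before_release feas feasA by (simp add: remaining_def)
  qed
  have sub: "released I t \<subseteq> released I (Suc t)" by (auto simp: released_def)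
  have eqY: "released I (Suc t) - ?Y = (released I t - Y') \<union> (?N - X)"
    and eqX: "released I (Suc t) - X = (released I t - X) \<union> (?N - X)"
    using sub Y' by auto
  have "(\<Sum>i\<in>released I t - X. remaining I S i t) \<le> (\<Sum>i\<in>released I t - X. remaining I S i (Suc t)) + 1"
    by (rule sum_remaining_step) simp
  then have "(\<Sum>i\<in>released I t - Y'. remaining I A i (Suc t)) \<le>
      (\<Sum>i\<in>released I t - X. remaining I S i (Suc t))"
    using Y(3) Y'(3) by linarith
  moreover have "(\<Sum>i\<in>?N - X. remaining I A i (Suc t)) = (\<Sum>i\<in>?N - X. remaining I S i (Suc t))"
    using new by (intro sum.cong) auto
  ultimately have le: "(\<Sum>i\<in>released I (Suc t) - ?Y. remaining I A i (Suc t)) \<le>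
      (\<Sum>i\<in>released I (Suc t) - X. remaining I S i (Suc t))"
    unfolding eqY eqX by (subst (1 2) sum.union_disjoint) auto
  have "card ?Y \<le> card Y' + card (X \<inter> ?N)" by (rule card_Un_le)
  also have "\<dots> \<le> card ?X + card (X \<inter> ?N)" using Y(2) Y'(2) by simp
  also have "\<dots> = card (?X \<union> (X \<inter> ?N))"
    using Suc.prems by (subst card_Un_disjoint) auto
  also have "\<dots> \<le> card X" using Suc.prems by (intro card_mono) auto
  finally have card: "card ?Y \<le> card X" .
  show ?case
    by (rule exI[of _ ?Y]) (use le card sub Y'(1) in auto)
qed


section \<open>The run of the algorithm\<close>

lemma num_left_bal_state:
  assumes "feasible I srpt"
  shows "num_left I (fst (bal_state I \<theta> srpt t)) i = remaining I (bal I \<theta> srpt) i t"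
  using bal_state_executed[OF assms, of i \<theta> t] by (simp add: num_left_def num_done_def remaining_def)

text \<open>The marks in force during slot \<open>t\<close>, that is, including those set at time \<open>t\<close>.\<close>

definition marks ::
  "job_instance \<Rightarrow> real \<Rightarrow> schedule \<Rightarrow> nat \<Rightarrow> nat \<Rightarrow> (nat \<times> real) option" where
  "marks I \<theta> srpt t = snd (bal_state I \<theta> srpt (Suc t))"

lemma snd_bal_state_Suc: "snd (bal_state I \<theta> srpt (Suc t)) = marks I \<theta> srpt t"
  by (simp only: marks_def)

lemma marks_eq:
  "marks I \<theta> srpt t = mark_starving I \<theta> t (bal_state I \<theta> srpt t)"
  by (simp add: marks_def Let_def split: prod.splits)

lemma bal_task_eq:
  "bal_task I \<theta> srpt t = bal_choice I srpt t (fst (bal_state I \<theta> srpt t), marks I \<theta> srpt t)"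
  by (simp add: bal_task_def marks_eq Let_def split: prod.splits)

lemma marks_cases:
  assumes "feasible I srpt"
  shows "marks I \<theta> srpt t i =
    (let q = real (remaining I (bal I \<theta> srpt) i t); w = real t - real (release I i) in
     if i \<in> released I t \<and> 0 < q \<and> snd (bal_state I \<theta> srpt t) i = None \<and> \<theta> * q \<le> w
     then Some (t, w / q) else snd (bal_state I \<theta> srpt t) i)"
proof -
  obtain M \<sigma> where st: "bal_state I \<theta> srpt t = (M, \<sigma>)" by fastforce
  then show ?thesis
    using num_left_bal_state[OF assms, of \<theta> t i]
    by (auto simp: marks_eq mark_starving_def bal_active_def released_def Let_def pos_le_divide_eq)
qed

lemma marks_persist:
  assumes "feasible I srpt" "marks I \<theta> srpt t i = Some x" "t \<le> u"
  shows "marks I \<theta> srpt u i = Some x"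
  using assms(3)
proof (induction u rule: dec_induct)
  case (step u)
  then show ?case
    by (simp add: marks_cases[OF assms(1), of \<theta> "Suc u"] snd_bal_state_Suc Let_def
        del: bal_state.simps)
qed (use assms in simp)

text \<open>A mark is set once and records the time of its setting. So the threshold test held at
  time \<open>s\<close>, and the job was normal in all earlier slots.\<close>

lemma marks_start:
  assumes feas: "feasible I srpt" and "marks I \<theta> srpt t i = Some (s, \<gamma>)"
  shows "s \<le> t \<and> i \<in> released I s \<and> 0 < remaining I (bal I \<theta> srpt) i s \<and>
    \<theta> * real (remaining I (bal I \<theta> srpt) i s) \<le> real s - real (release I i) \<and>
    snd (bal_state I \<theta> srpt s) i = None \<and> marks I \<theta> srpt s i = Some (s, \<gamma>)"
  using assms(2)
proof (induction t)
  case 0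
  then show ?case
    by (auto simp: marks_cases[OF feas] Let_def split: if_splits)
next
  case (Suc t)
  show ?case
  proof (cases "marks I \<theta> srpt t i")
    case None
    then show ?thesis using Suc.prems
      by (auto simp: marks_cases[OF feas, of \<theta> "Suc t"] snd_bal_state_Suc Let_def
          simp del: bal_state.simps split: if_splits)
  next
    case (Some x)
    then have "marks I \<theta> srpt (Suc t) i = Some x" using marks_persist[OF feas Some, of "Suc t"] by simp
    then show ?thesis using Suc.IH Suc.prems Some by simp
  qed
qed

lemma marks_None:
  assumes "feasible I srpt" "marks I \<theta> srpt t i = None" "i \<in> released I t"
    and "0 < remaining I (bal I \<theta> srpt) i t"
  shows "real t - real (release I i) < \<theta> * real (remaining I (bal I \<theta> srpt) i t)"
  using assms by (auto simp: marks_cases Let_def not_le split: if_splits)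

lemma bal_starving:
  assumes feas: "feasible I srpt" and j: "marks I \<theta> srpt t j = Some (s, \<gamma>)"
    and "j \<in> released I t" "0 < remaining I (bal I \<theta> srpt) j t"
  shows "\<exists>i s' \<gamma>'. bal I \<theta> srpt t = Some i \<and> marks I \<theta> srpt t i = Some (s', \<gamma>') \<and> s' \<le> s"
proof -
  let ?st = "(fst (bal_state I \<theta> srpt t), marks I \<theta> srpt t)"
  have sj: "starving_active I t ?st j"
    using assms num_left_bal_state[OF feas, of \<theta> t j]
    by (simp add: starving_active_def bal_active_def released_def)
  then have ex: "\<exists>i. starving_active I t ?st i" by blast
  define i where "i = (THE i. starving_active I t ?st i \<and>
      (\<forall>j. starving_active I t ?st j \<longrightarrow> starving_before (marks I \<theta> srpt t) i j))"
  have i: "starving_active I t ?st i" "starving_before (marks I \<theta> srpt t) i j"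
    using theI'[OF starving_choice[OF ex]] sj unfolding i_def by blast+
  have "bal I \<theta> srpt t = Some i"
    using ex by (simp add: bal_def bal_task_eq bal_choice_def Let_def i_def)
  moreover obtain s' \<gamma>' where m: "marks I \<theta> srpt t i = Some (s', \<gamma>')"
    using i(1) by (auto simp: starving_active_def)
  moreover have "s' \<le> s" using i(2) m j by (auto simp: starving_before_def)
  ultimately show ?thesis by blast
qed

text \<open>A normal job receives slots only through the rule that picks tasks which SRPT has
  executed by the end of the same slot.\<close>

lemma unmarked_not_ahead:
  assumes "feasible I srpt" "snd (bal_state I \<theta> srpt t) i = None"
  shows "executed (bal I \<theta> srpt) i t \<le> executed srpt i t"
  using assms(2)
proof (induction t)
  case (Suc t)
  then have none: "marks I \<theta> srpt t i = None" by (simp only: snd_bal_state_Suc)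
  then have "snd (bal_state I \<theta> srpt t) i = None"
    by (auto simp: marks_cases[OF assms(1)] Let_def split: if_splits)
  then have IH: "executed (bal I \<theta> srpt) i t \<le> executed srpt i t" by (rule Suc.IH)
  show ?case
  proof (cases "bal I \<theta> srpt t = Some i")
    case False
    then show ?thesis using IH by (simp add: executed_Suc)
  next
    case True
    then obtain k where k: "bal_task I \<theta> srpt t = Some (i, k)" by (auto simp: bal_def)
    let ?st = "(fst (bal_state I \<theta> srpt t), marks I \<theta> srpt t)"
    have kk: "k = Suc (executed (bal I \<theta> srpt) i t)"
      using bal_task_next[OF assms(1) k] by blast
    have "\<not> (\<exists>i. starving_active I t ?st i)"
    proof
      assume ex: "\<exists>i. starving_active I t ?st i"
      then have "starving_active I t ?st i"
        using k theI'[OF starving_choice[OF ex]] by (auto simp: bal_task_eq bal_choice_def Let_def)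
      then show False using none by (simp add: starving_active_def)
    qed
    then have ne: "tasks_upto srpt t - fst (bal_state I \<theta> srpt t) \<noteq> {}"
      and am: "(i, k) = arg_min (task_completion srpt)
        (\<lambda>\<tau>. \<tau> \<in> tasks_upto srpt t - fst (bal_state I \<theta> srpt t))"
      using k by (auto simp: bal_task_eq bal_choice_def split: if_splits)
    have "(i, k) \<in> tasks_upto srpt t - fst (bal_state I \<theta> srpt t)"
      unfolding am using ne by (metis (no_types, lifting) arg_min_natI ex_in_conv)
    then obtain u where u: "u \<le> t" "srpt u = Some i" "k = Suc (executed srpt i u)"
      by (auto simp: tasks_upto_def task_at_eq_Some)
    have "k \<le> executed srpt i (Suc t)"
      using u executed_mono[of "Suc u" "Suc t" srpt i] by (simp add: executed_Suc)
    then show ?thesis using True kk by (simp add: executed_Suc)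
  qed
qed simp

section \<open>Work conservation and total volume\<close>

lemma sum_executed_Suc:
  assumes "feasible I S"
  shows "(\<Sum>i<njobs I. executed S i (Suc t)) =
    (\<Sum>i<njobs I. executed S i t) + (if S t = None then 0 else 1)"
proof -
  have "(\<exists>i\<in>{..<njobs I}. S t = Some i) \<longleftrightarrow> S t \<noteq> None"
    using assms by (auto simp: feasible_def)
  then show ?thesis by (simp add: executed_Suc sum.distrib sum_slot_indicator)
qed

text \<open>A busy slot adds a unit to BAL and at most one to SRPT. In an idle slot BAL has already
  executed every task of SRPT up to that slot.\<close>

lemma bal_work_conserving:
  assumes "feasible I srpt"
  shows "(\<Sum>i<njobs I. executed srpt i t) \<le> (\<Sum>i<njobs I. executed (bal I \<theta> srpt) i t)"
proof (induction t)
  case (Suc t)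
  show ?case
  proof (cases "bal I \<theta> srpt t = None")
    case False
    then show ?thesis
      using Suc unfolding sum_executed_Suc[OF assms] sum_executed_Suc[OF bal_feasible[OF assms]]
      by (auto intro: le_SucI)
  next
    case True
    have "executed srpt i (Suc t) \<le> executed (bal I \<theta> srpt) i (Suc t)" for i
    proof (rule ccontr)
      assume "\<not> ?thesis"
      then have "Suc (executed (bal I \<theta> srpt) i t) \<le> executed srpt i (Suc t)"
        using True by (simp add: executed_Suc)
      then obtain s where "s < Suc t" "task_at srpt s = Some (i, Suc (executed (bal I \<theta> srpt) i t))"
        using task_at_exists[of "Suc (executed (bal I \<theta> srpt) i t)" srpt i "Suc t"] by auto
      then have "(i, Suc (executed (bal I \<theta> srpt) i t)) \<in> tasks_upto srpt t"
        by (auto simp: tasks_upto_def less_Suc_eq_le)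
      moreover have "Suc (executed (bal I \<theta> srpt) i t) \<notin> {k. (i, k) \<in> fst (bal_state I \<theta> srpt t)}"
        unfolding bal_state_executed[OF assms] by simp
      ultimately have "tasks_upto srpt t - fst (bal_state I \<theta> srpt t) \<noteq> {}" by blast
      then show False using True
        by (auto simp: bal_def bal_task_eq bal_choice_def Let_def split: if_splits)
    qed
    then show ?thesis by (rule sum_mono)
  qed
qed simp

lemma sum_remaining_released:
  assumes "feasible I S"
  shows "(\<Sum>i\<in>released I t. remaining I S i t) + (\<Sum>i<njobs I. executed S i t)
    = (\<Sum>i\<in>released I t. proc I i)"
proof -
  have "(\<Sum>i<njobs I. executed S i t) = (\<Sum>i\<in>released I t. executed S i t)"
    by (rule sum.mono_neutral_right)
       (auto simp: released_def not_le intro!: executed_before_release[OF assms])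
  then have "(\<Sum>i\<in>released I t. remaining I S i t) + (\<Sum>i<njobs I. executed S i t)
      = (\<Sum>i\<in>released I t. remaining I S i t + executed S i t)"
    by (simp add: sum.distrib)
  also have "\<dots> = (\<Sum>i\<in>released I t. proc I i)"
    using feasible_executed_le[OF assms] by (intro sum.cong) (auto simp: remaining_def released_def)
  finally show ?thesis .
qed

lemma bal_remaining_le:
  assumes "feasible I srpt"
  shows "(\<Sum>i\<in>released I t. remaining I (bal I \<theta> srpt) i t) \<le> (\<Sum>i\<in>released I t. remaining I srpt i t)"
  using sum_remaining_released[OF assms, of t] bal_work_conserving[OF assms, where t = t and \<theta> = \<theta>]
    sum_remaining_released[OF bal_feasible[OF assms], where t = t and \<theta>1 = \<theta>]
  by linarith

text \<open>\<open>srpt_dominates\<close> with no job excluded makes SRPT minimize the total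
  remaining work at each time, and BAL has no more left than SRPT. Grouping the volume by jobs lets
  each job be charged to its own share.\<close>

lemma bal_volume_le:
  assumes val: "valid_instance I" and srpt: "srpt_schedule I srpt" and feas: "feasible I S"
  shows "real (\<Sum>i<njobs I. \<Sum>t | t < T \<and> release I i \<le> t. remaining I (bal I \<theta> srpt) i t)
    \<le> sq_flow I S"
proof -
  have "(\<Sum>i\<in>released I t. remaining I (bal I \<theta> srpt) i t) \<le> (\<Sum>i\<in>released I t. remaining I S i t)"
    for t
  proof -
    have "(\<Sum>i\<in>released I t. remaining I srpt i t) \<le> (\<Sum>i\<in>released I t. remaining I S i t)"
      using srpt_dominates[OF srpt val feas, of "{}" t] by (auto dest: finite_subset)
    then show ?thesis
      using bal_remaining_le[of I srpt \<theta> t] srpt by (simp add: srpt_schedule_def)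
  qed
  then have "(\<Sum>t<T. \<Sum>i\<in>released I t. remaining I (bal I \<theta> srpt) i t)
      \<le> (\<Sum>t<T. \<Sum>i\<in>released I t. remaining I S i t)"
    by (rule sum_mono)
  then have "real (\<Sum>t<T. \<Sum>i\<in>released I t. remaining I (bal I \<theta> srpt) i t)
      \<le> real (\<Sum>t<T. \<Sum>i\<in>released I t. remaining I S i t)"
    by (simp only: of_nat_le_iff)
  also have "\<dots> \<le> sq_flow I S" by (rule sum_remaining_le_sq_flow[OF val feas])
  finally show ?thesis by (simp only: sum_released_swap)
qed

section \<open>Waiting before and after a job becomes starving\<close>

lemma job_volume_ge:
  assumes "release I i \<le> s" "s \<le> T" and q: "\<And>t. t < s \<Longrightarrow> q \<le> remaining I S i t"
  shows "(s - release I i) * q \<le> (\<Sum>t | t < T \<and> release I i \<le> t. remaining I S i t)"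
proof -
  have "(s - release I i) * q = (\<Sum>t\<in>{release I i..<s}. q)" by simp
  also have "\<dots> \<le> (\<Sum>t\<in>{release I i..<s}. remaining I S i t)"
    by (rule sum_mono) (use q in auto)
  also have "\<dots> \<le> (\<Sum>t | t < T \<and> release I i \<le> t. remaining I S i t)"
    by (rule sum_mono2) (use assms in auto)
  finally show ?thesis .
qed

text \<open>With q units left and waiting time w, the failed threshold test gives w < \<theta> q + 1
  \<le> 2 \<theta> q, and w q is at most the job's share of the volume.\<close>

lemma normal_phase_sq_le:
  fixes \<theta> :: real
  assumes feas: "feasible I srpt" and \<theta>: "1 \<le> \<theta>" and rel: "j \<in> released I u"
    and none: "marks I \<theta> srpt u j = None" and pos: "0 < remaining I (bal I \<theta> srpt) j u"
    and "Suc u \<le> T"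
  shows "(real (Suc u) - real (release I j))\<^sup>2
    \<le> 2 * \<theta> * real (\<Sum>t | t < T \<and> release I j \<le> t. remaining I (bal I \<theta> srpt) j t)"
proof -
  let ?q = "remaining I (bal I \<theta> srpt) j u"
  let ?w = "real (Suc u) - real (release I j)"
  let ?V = "\<Sum>t | t < T \<and> release I j \<le> t. remaining I (bal I \<theta> srpt) j t"
  have r: "release I j \<le> u" using rel by (simp add: released_def)
  have "1 \<le> \<theta> * real ?q" using mult_mono[of 1 \<theta> 1 "real ?q"] \<theta> pos by simp
  then have w: "?w \<le> 2 * \<theta> * real ?q"
    using marks_None[OF feas none rel pos] by simp
  have "(Suc u - release I j) * ?q \<le> ?V"
    by (rule job_volume_ge) (use r assms(6) in \<open>auto intro!: remaining_antimono\<close>)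
  then have "real ((Suc u - release I j) * ?q) \<le> real ?V" by (simp only: of_nat_le_iff)
  then have v: "?w * real ?q \<le> real ?V" using r by (simp add: of_nat_diff)
  have "?w\<^sup>2 \<le> ?w * (2 * \<theta> * real ?q)"
    unfolding power2_eq_square using w r by (intro mult_left_mono) auto
  also have "\<dots> = 2 * \<theta> * (?w * real ?q)" by simp
  also have "\<dots> \<le> 2 * \<theta> * real ?V" using v \<theta> by (intro mult_left_mono) auto
  finally show ?thesis .
qed

text \<open>Marks are never removed, so completed jobs stay in this set; they carry no remaining
  work.\<close>

definition starving :: "job_instance \<Rightarrow> real \<Rightarrow> schedule \<Rightarrow> nat \<Rightarrow> nat set" where
  "starving I \<theta> srpt t = {i \<in> released I t. marks I \<theta> srpt t i \<noteq> None}"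

text \<open>By the priority rule, only jobs already starving at time \<open>s\<close> can precede \<open>j\<close>.\<close>

lemma starving_phase_le:
  assumes val: "valid_instance I" and feas: "feasible I srpt" and "j < njobs I"
    and j: "marks I \<theta> srpt s j = Some (s, \<gamma>)"
  shows "completion (bal I \<theta> srpt) j - s
    \<le> (\<Sum>i\<in>starving I \<theta> srpt s. remaining I (bal I \<theta> srpt) i s)"
proof -
  let ?B = "bal I \<theta> srpt"
  let ?K = "starving I \<theta> srpt s"
  have fin: "finite ?K" by (simp add: starving_def)
  have feasB: "feasible I ?B" by (rule bal_feasible[OF feas])
  have rj: "release I j \<le> s" using marks_start[OF feas j] by (simp add: released_def)
  \<comment> \<open>Until \<open>j\<close> completes, each slot executes a job of \<open>?K\<close>
    and so removes a unit from the work of \<open>?K\<close>.\<close>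
  have "(\<Sum>i\<in>?K. remaining I ?B i (s + d)) + d \<le> (\<Sum>i\<in>?K. remaining I ?B i s)"
    if "s + d \<le> completion ?B j" for d
    using that
  proof (induction d)
    case (Suc d)
    let ?t = "s + d"
    have "0 < remaining I ?B j ?t"
      using remaining_pos_iff[OF val feasB \<open>j < njobs I\<close>] Suc.prems by simp
    moreover have "j \<in> released I ?t" using rj \<open>j < njobs I\<close> by (simp add: released_def)
    moreover have "marks I \<theta> srpt ?t j = Some (s, \<gamma>)" using marks_persist[OF feas j, of ?t] by simp
    ultimately obtain i s' \<gamma>' where i: "?B ?t = Some i" "marks I \<theta> srpt ?t i = Some (s', \<gamma>')" "s' \<le> s"
      using bal_starving[OF feas] by blast
    have "i \<in> released I s'" "marks I \<theta> srpt s' i = Some (s', \<gamma>')"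
      using marks_start[OF feas i(2)] by auto
    then have K: "i \<in> ?K"
      using marks_persist[OF feas _ i(3)] i(3) by (auto simp: starving_def released_def)
    have "executed ?B i (Suc ?t) \<le> proc I i"
      using feasible_executed_le[OF feasB] K by (simp add: starving_def released_def)
    then have "remaining I ?B i ?t = Suc (remaining I ?B i (Suc ?t))"
      using i(1) by (simp add: remaining_def executed_Suc)
    moreover have "(\<Sum>i\<in>?K - {i}. remaining I ?B i (Suc ?t)) \<le> (\<Sum>i\<in>?K - {i}. remaining I ?B i ?t)"
      by (rule sum_mono) (simp add: remaining_antimono)
    ultimately have "(\<Sum>i\<in>?K. remaining I ?B i (Suc ?t)) + 1 \<le> (\<Sum>i\<in>?K. remaining I ?B i ?t)"
      using fin K by (simp add: sum.remove[of ?K i])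
    then show ?case using Suc by simp
  qed simp
  from this[of "completion ?B j - s"] show ?thesis
    by (cases "s \<le> completion ?B j") auto
qed


section \<open>The work of the starving jobs\<close>

text \<open>The work left at the moment recorded in the mark; meaningful for marked jobs
  only.\<close>

definition starving_size :: "job_instance \<Rightarrow> real \<Rightarrow> schedule \<Rightarrow> nat \<Rightarrow> nat \<Rightarrow> nat" where
  "starving_size I \<theta> srpt t i =
     remaining I (bal I \<theta> srpt) i (fst (the (marks I \<theta> srpt t i)))"

text \<open>Jobs outside \<open>Y\<close> can only be late relative to SRPT if BAL is ahead of SRPT on jobs of \<open>Y\<close>, and on a
  job \<open>i\<close> it can be ahead by at most the work \<open>i\<close> had left when it became starving.\<close>

lemma starving_work_split:
  assumes feas: "feasible I srpt" and Y: "Y \<subseteq> released I t"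
  shows "(\<Sum>i\<in>starving I \<theta> srpt t. remaining I (bal I \<theta> srpt) i t)
    \<le> (\<Sum>i\<in>released I t - Y. remaining I srpt i t)
      + (\<Sum>i\<in>Y \<inter> starving I \<theta> srpt t. starving_size I \<theta> srpt t i)"
proof -
  let ?B = "bal I \<theta> srpt"
  let ?K = "starving I \<theta> srpt t"
  let ?b = "\<lambda>i. remaining I ?B i t"
  let ?a = "\<lambda>i. remaining I srpt i t"
  have finY: "finite Y" using Y finite_subset by fastforce
  have 1: "?a i \<le> starving_size I \<theta> srpt t i" if K: "i \<in> ?K" for i
  proof -
    from K obtain s \<gamma> where m: "marks I \<theta> srpt t i = Some (s, \<gamma>)"
      by (auto simp: starving_def)
    have "?a i \<le> remaining I srpt i s"
      using marks_start[OF feas m] by (simp add: remaining_antimono)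
    also have "\<dots> \<le> remaining I ?B i s"
      using unmarked_not_ahead[OF feas, of \<theta> s i] marks_start[OF feas m]
      by (simp add: remaining_def)
    finally show ?thesis by (simp add: starving_size_def m)
  qed
  have 2: "?a i \<le> ?b i" if "i \<in> Y - ?K" for i
  proof -
    have "marks I \<theta> srpt t i = None" using that Y unfolding starving_def by blast
    then have "snd (bal_state I \<theta> srpt t) i = None"
      by (auto simp: marks_cases[OF feas] Let_def split: if_splits)
    then show ?thesis using unmarked_not_ahead[OF feas] by (simp add: remaining_def diff_le_mono2)
  qed
  have split: "(\<Sum>i\<in>released I t. f i) =
      (\<Sum>i\<in>released I t - Y. f i) + ((\<Sum>i\<in>Y \<inter> ?K. f i) + (\<Sum>i\<in>Y - ?K. f i))" for f :: "nat \<Rightarrow> nat"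
  proof -
    have "(\<Sum>i\<in>released I t. f i) = (\<Sum>i\<in>released I t - Y. f i) + (\<Sum>i\<in>Y. f i)"
      using Y by (simp add: sum.subset_diff)
    also have "(\<Sum>i\<in>Y. f i) = (\<Sum>i\<in>Y \<inter> ?K. f i) + (\<Sum>i\<in>Y - ?K. f i)"
      using finY by (simp add: sum.Int_Diff)
    finally show ?thesis .
  qed
  have "(\<Sum>i\<in>?K. ?b i) \<le> (\<Sum>i\<in>released I t - Y. ?b i) + (\<Sum>i\<in>Y \<inter> ?K. ?b i)"
  proof -
    have "(\<Sum>i\<in>?K. ?b i) \<le> (\<Sum>i\<in>(released I t - Y) \<union> (Y \<inter> ?K). ?b i)"
      by (rule sum_mono2) (use finY in \<open>auto simp: starving_def\<close>)
    also have "\<dots> \<le> (\<Sum>i\<in>released I t - Y. ?b i) + (\<Sum>i\<in>Y \<inter> ?K. ?b i)"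
      using finY by (subst sum.union_disjoint) auto
    finally show ?thesis .
  qed
  moreover have "(\<Sum>i\<in>released I t. ?b i) \<le> (\<Sum>i\<in>released I t. ?a i)"
    by (rule bal_remaining_le[OF feas])
  moreover have "(\<Sum>i\<in>Y \<inter> ?K. ?a i) \<le> (\<Sum>i\<in>Y \<inter> ?K. starving_size I \<theta> srpt t i)"
    using 1 by (intro sum_mono) auto
  moreover have "(\<Sum>i\<in>Y - ?K. ?a i) \<le> (\<Sum>i\<in>Y - ?K. ?b i)"
    using 2 by (intro sum_mono) auto
  \<comment> \<open>The work on \<open>?K\<close> is at most the total of \<open>?b\<close> minus
    its part on \<open>Y - ?K\<close>. Passing to \<open>?a\<close> increases the total and
    decreases the subtracted part; what remains is the part of \<open>?a\<close> outside
    \<open>Y\<close> and on \<open>Y \<inter> ?K\<close>.\<close>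
  ultimately show ?thesis using split[of ?a] split[of ?b] by linarith
qed

text \<open>A job that starts starving with q units left has waited at least \<theta> q with at
  least q units left throughout, so its share of the volume is at least \<theta> q squared.\<close>

lemma starving_sum_squares_le:
  assumes val: "valid_instance I" and srpt: "srpt_schedule I srpt" and feasS: "feasible I S"
    and Y: "Y \<subseteq> starving I \<theta> srpt t"
  shows "\<theta> * (\<Sum>i\<in>Y. (real (starving_size I \<theta> srpt t i))\<^sup>2) \<le> sq_flow I S"
proof -
  let ?B = "bal I \<theta> srpt"
  let ?V = "\<lambda>i. \<Sum>u | u < t \<and> release I i \<le> u. remaining I ?B i u"
  have feas: "feasible I srpt" using srpt by (simp add: srpt_schedule_def)
  have "\<theta> * (real (starving_size I \<theta> srpt t i))\<^sup>2 \<le> real (?V i)" if "i \<in> Y" for i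
  proof -
    from that Y obtain s \<gamma> where m: "marks I \<theta> srpt t i = Some (s, \<gamma>)"
      by (auto simp: starving_def)
    note st = marks_start[OF feas m]
    have q: "starving_size I \<theta> srpt t i = remaining I ?B i s" by (simp add: starving_size_def m)
    have r: "release I i \<le> s" using st by (simp add: released_def)
    have "\<theta> * (real (starving_size I \<theta> srpt t i))\<^sup>2
        = (\<theta> * real (starving_size I \<theta> srpt t i)) * real (starving_size I \<theta> srpt t i)"
      by (simp add: power2_eq_square)
    also have "\<dots> \<le> (real s - real (release I i)) * real (starving_size I \<theta> srpt t i)"
      using st unfolding q by (intro mult_right_mono) auto
    also have "\<dots> = real ((s - release I i) * starving_size I \<theta> srpt t i)" using r by (simp add: of_nat_diff)
    also have "(s - release I i) * starving_size I \<theta> srpt t i \<le> ?V i"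
      unfolding q by (rule job_volume_ge) (use st r in \<open>auto intro!: remaining_antimono\<close>)
    finally show ?thesis by simp
  qed
  then have "\<theta> * (\<Sum>i\<in>Y. (real (starving_size I \<theta> srpt t i))\<^sup>2) \<le> (\<Sum>i\<in>Y. real (?V i))"
    unfolding sum_distrib_left by (rule sum_mono)
  also have "\<dots> \<le> (\<Sum>i<njobs I. real (?V i))"
    by (rule sum_mono2) (use Y in \<open>auto simp: starving_def released_def sum_nonneg\<close>)
  also have "\<dots> \<le> sq_flow I S"
    using bal_volume_le[OF val srpt feasS, of \<theta> t] by (simp only: of_nat_sum)
  finally show ?thesis .
qed

text \<open>The work is at most \<open>D + Q\<close>, where \<open>D\<close> is bounded by the
  spread of the work in \<open>S\<close> and \<open>Q\<close> by Cauchy-Schwarz over at most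
  \<open>m\<close> jobs. Both squares are at most
  \<open>sq_flow I S / sqrt \<theta>\<close>.\<close>

lemma starving_work_sq_le:
  fixes srpt :: schedule and \<theta> :: real
  assumes val: "valid_instance I" and srpt: "srpt_schedule I srpt" and feasS: "feasible I S"
    and \<theta>: "1 \<le> \<theta>"
  shows "(real (\<Sum>i\<in>starving I \<theta> srpt t. remaining I (bal I \<theta> srpt) i t))\<^sup>2
    \<le> 4 / sqrt \<theta> * sq_flow I S"
proof -
  let ?K = "starving I \<theta> srpt t"
  let ?W = "\<Sum>i\<in>?K. remaining I (bal I \<theta> srpt) i t"
  let ?F = "sq_flow I S"
  have feas: "feasible I srpt" using srpt by (simp add: srpt_schedule_def)
  \<comment> \<open>\<open>\<surd>\<theta>\<close> balances the bounds \<open>F / (m + 1)\<close> and \<open>m F / \<theta>\<close> obtained below\<close>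
  define m where "m = nat \<lfloor>sqrt \<theta>\<rfloor>"
  have s1: "1 \<le> sqrt \<theta>" using \<theta> by simp
  have m: "real m \<le> sqrt \<theta>" "sqrt \<theta> \<le> real (Suc m)"
    unfolding m_def using s1 by linarith+
  \<comment> \<open>The minimizing \<open>X\<close> makes \<open>D\<close> a lower bound for the
    work outside any \<open>m\<close> jobs, as \<open>sq_flow_ge_of_spread_work\<close>
    requires.\<close>
  obtain X where X: "finite X \<and> card X \<le> m"
    "\<forall>X'. finite X' \<and> card X' \<le> m \<longrightarrow>
      (\<Sum>i\<in>released I t - X. remaining I S i t) \<le> (\<Sum>i\<in>released I t - X'. remaining I S i t)"
    using ex_has_least_nat[of "\<lambda>X. finite X \<and> card X \<le> m" "{}"
        "\<lambda>X. \<Sum>i\<in>released I t - X. remaining I S i t"] by auto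
  define D where "D = (\<Sum>i\<in>released I t - X. remaining I S i t)"
  have "real (Suc m) * (real D)\<^sup>2 \<le> ?F"
    by (rule sq_flow_ge_of_spread_work[OF val feasS, of m D t]) (use X(2) D_def in blast)
  then have "sqrt \<theta> * (real D)\<^sup>2 \<le> ?F"
    using m(2) by (meson mult_right_mono order_trans zero_le_power2)
  then have D: "(real D)\<^sup>2 \<le> ?F / sqrt \<theta>" using s1 by (simp add: field_simps)
  obtain Y where Y: "Y \<subseteq> released I t" "card Y \<le> card X"
    "(\<Sum>i\<in>released I t - Y. remaining I srpt i t) \<le> D"
    using srpt_dominates[OF srpt val feasS, of X t] X(1) D_def by blast
  have finY: "finite Y" using Y(1) finite_subset by fastforce
  define Q where "Q = (\<Sum>i\<in>Y \<inter> ?K. starving_size I \<theta> srpt t i)"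
  have W: "?W \<le> D + Q"
    using starving_work_split[OF feas Y(1), of \<theta>] Y(3) unfolding Q_def by linarith
  have "card (Y \<inter> ?K) \<le> m"
    using card_mono[of Y "Y \<inter> ?K"] finY Y(2) X(1) by simp
  then have cs: "real (card (Y \<inter> ?K)) \<le> sqrt \<theta>" using m(1) by linarith
  have "(real Q)\<^sup>2 = (\<Sum>i\<in>Y \<inter> ?K. real (starving_size I \<theta> srpt t i))\<^sup>2" by (simp add: Q_def)
  also have "\<dots> \<le> (\<Sum>i\<in>Y \<inter> ?K. (real (starving_size I \<theta> srpt t i))\<^sup>2) * real (card (Y \<inter> ?K))"
    by (rule sum_squared_le_sum_of_squares)
  also have "\<dots> \<le> (\<Sum>i\<in>Y \<inter> ?K. (real (starving_size I \<theta> srpt t i))\<^sup>2) * sqrt \<theta>"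
    using cs by (intro mult_left_mono) (auto intro: sum_nonneg)
  finally have "(real Q)\<^sup>2 * sqrt \<theta>
      \<le> (\<Sum>i\<in>Y \<inter> ?K. (real (starving_size I \<theta> srpt t i))\<^sup>2) * sqrt \<theta> * sqrt \<theta>"
    using s1 by (intro mult_right_mono) auto
  also have "\<dots> = \<theta> * (\<Sum>i\<in>Y \<inter> ?K. (real (starving_size I \<theta> srpt t i))\<^sup>2)"
    using \<theta> by (simp add: mult.assoc)
  also have "\<dots> \<le> ?F"
    by (rule starving_sum_squares_le[OF val srpt feasS]) simp
  finally have Q: "(real Q)\<^sup>2 \<le> ?F / sqrt \<theta>" using s1 by (simp add: field_simps)
  have "(real ?W)\<^sup>2 \<le> (real D + real Q)\<^sup>2"
    using W by (intro power_mono) (simp_all only: of_nat_0_le_iff of_nat_add[symmetric] of_nat_le_iff)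
  also have "\<dots> \<le> 2 * (real D)\<^sup>2 + 2 * (real Q)\<^sup>2"
    using sum_squares_bound[of "real D" "real Q"] by (simp add: power2_sum)
  also have "\<dots> \<le> 4 / sqrt \<theta> * ?F" using D Q by simp
  finally show ?thesis .
qed


section \<open>The competitive ratio\<close>

text \<open>The flow time is split at the start of starving, if there is one; squaring the sum of
  the two parts doubles both bounds.\<close>

lemma bal_flow_sq_le:
  fixes srpt :: schedule and \<theta> :: real
  assumes val: "valid_instance I" and srpt: "srpt_schedule I srpt" and feasS: "feasible I S"
    and \<theta>: "1 \<le> \<theta>" and j: "j < njobs I" and T: "completion (bal I \<theta> srpt) j \<le> T"
  shows "(flow_time I (bal I \<theta> srpt) j)\<^sup>2
    \<le> 4 * \<theta> * real (\<Sum>t | t < T \<and> release I j \<le> t. remaining I (bal I \<theta> srpt) j t)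
      + 8 / sqrt \<theta> * sq_flow I S"
proof -
  let ?B = "bal I \<theta> srpt"
  let ?V = "\<Sum>t | t < T \<and> release I j \<le> t. remaining I ?B j t"
  let ?F = "sq_flow I S"
  have feas: "feasible I srpt" using srpt by (simp add: srpt_schedule_def)
  have feasB: "feasible I ?B" by (rule bal_feasible[OF feas])
  note pos = remaining_pos_iff[OF val feasB j]
  have F0: "0 \<le> 8 / sqrt \<theta> * ?F" using \<theta> by (simp add: sq_flow_def sum_nonneg)
  have V0: "0 \<le> \<theta> * real ?V" using \<theta> by (intro mult_nonneg_nonneg of_nat_0_le_iff) simp
  obtain u where u: "completion ?B j = Suc u" by (simp add: completion_def)
  have r: "release I j \<le> u" using release_less_completion[OF val feasB j] u by simp
  show ?thesis
  proof (cases "marks I \<theta> srpt u j")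
    case None
    have "(flow_time I ?B j)\<^sup>2 \<le> 2 * \<theta> * real ?V"
      using normal_phase_sq_le[OF feas \<theta> _ None, of T] r j pos[of u] u T
      by (simp add: flow_time_def released_def)
    then show ?thesis using F0 V0 by linarith
  next
    case (Some x)
    then obtain s \<gamma> where m: "marks I \<theta> srpt u j = Some (s, \<gamma>)" by (cases x) auto
    note st = marks_start[OF feas m]
    \<comment> \<open>A positive threshold rules out starving at release, so slot \<open>v\<close>
      just before \<open>s\<close> exists and \<open>j\<close> is still normal in it.\<close>
    have "0 < \<theta> * real (remaining I ?B j s)" using st \<theta> by simp
    then have rs: "release I j < s" using st by linarith
    then obtain v where v: "s = Suc v" by (cases s) auto
    have none: "marks I \<theta> srpt v j = None" using st unfolding v snd_bal_state_Suc by simp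
    have "0 < remaining I ?B j v" using st remaining_antimono[of v s I ?B j] v by simp
    then have 1: "(real s - real (release I j))\<^sup>2 \<le> 2 * \<theta> * real ?V"
      using normal_phase_sq_le[OF feas \<theta> _ none, of T] rs j v u T st by (simp add: released_def)
    let ?W = "\<Sum>i\<in>starving I \<theta> srpt s. remaining I ?B i s"
    have "completion ?B j - s \<le> ?W"
      using starving_phase_le[OF val feas j, of \<theta> s \<gamma>] st by simp
    then have "real (completion ?B j - s) \<le> real ?W" by (simp only: of_nat_le_iff)
    then have "(real (completion ?B j - s))\<^sup>2 \<le> (real ?W)\<^sup>2" by (intro power_mono) auto
    also have "\<dots> \<le> 4 / sqrt \<theta> * ?F" by (rule starving_work_sq_le[OF val srpt feasS \<theta>])
    finally have 2: "(real (completion ?B j - s))\<^sup>2 \<le> 4 / sqrt \<theta> * ?F" .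
    have "flow_time I ?B j = (real s - real (release I j)) + real (completion ?B j - s)"
      using st u by (simp add: flow_time_def of_nat_diff)
    then have "(flow_time I ?B j)\<^sup>2
        \<le> 2 * (real s - real (release I j))\<^sup>2 + 2 * (real (completion ?B j - s))\<^sup>2"
      using sum_squares_bound[of "real s - real (release I j)" "real (completion ?B j - s)"]
      by (simp add: power2_sum)
    then show ?thesis using 1 2 by simp
  qed
qed

text \<open>The volume shares of all jobs together cost \<open>sq_flow I S\<close> only once,
  whereas the starving delay is paid by each job separately; hence the factor \<open>njobs I\<close>
  in the second term only.\<close>

lemma bal_sq_flow_le:
  fixes srpt :: schedule and \<theta> :: real
  assumes val: "valid_instance I" and srpt: "srpt_schedule I srpt" and feasS: "feasible I S"
    and \<theta>: "1 \<le> \<theta>"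
  shows "sq_flow I (bal I \<theta> srpt)
    \<le> (4 * \<theta> + 8 * real (njobs I) / sqrt \<theta>) * sq_flow I S"
proof -
  let ?B = "bal I \<theta> srpt"
  let ?F = "sq_flow I S"
  \<comment> \<open>Any horizon beyond all completion times would do; the sum is one.\<close>
  define T where "T = (\<Sum>j<njobs I. completion ?B j)"
  let ?V = "\<lambda>j. \<Sum>t | t < T \<and> release I j \<le> t. remaining I ?B j t"
  have "completion ?B j \<le> T" if "j < njobs I" for j
    unfolding T_def using that by (intro member_le_sum) auto
  then have "sq_flow I ?B \<le> (\<Sum>j<njobs I. 4 * \<theta> * real (?V j) + 8 / sqrt \<theta> * ?F)"
    unfolding sq_flow_def[of I ?B]
    by (intro sum_mono bal_flow_sq_le[OF val srpt feasS \<theta>]) auto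
  also have "\<dots> = 4 * \<theta> * real (\<Sum>j<njobs I. ?V j) + 8 * real (njobs I) / sqrt \<theta> * ?F"
    by (simp add: sum.distrib sum_distrib_left)
  also have "\<dots> \<le> 4 * \<theta> * ?F + 8 * real (njobs I) / sqrt \<theta> * ?F"
    using bal_volume_le[OF val srpt feasS, of \<theta> T] \<theta> by (intro add_right_mono mult_left_mono) auto
  finally show ?thesis by (simp add: algebra_simps)
qed

text \<open>The first term grows with \<open>n'\<close> and is estimated at
  \<open>\<alpha> * n\<close>; the second decreases and is estimated at
  \<open>\<beta> * n\<close>.\<close>

lemma sqrt_ratio_le:
  fixes n \<alpha> \<beta> n' :: real
  assumes "0 < n" "0 < \<beta>" "0 < \<alpha>" "\<beta> * n \<le> n'" "n' \<le> \<alpha> * n"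
  shows "sqrt (4 * n' powr (2/3) + 8 * n / sqrt (n' powr (2/3)))
    \<le> 3 * n powr (1/3) * (\<beta> powr (-1/6) + \<alpha> powr (1/3))"
proof -
  have bn: "0 < \<beta> * n" using assms by simp
  then have n': "0 < n'" using assms by linarith
  \<comment> \<open>These are roots of the two terms, with 8 rounded up to the square 9.\<close>
  let ?a = "2 * n' powr (1/3)" and ?b = "3 * n powr (1/2) * n' powr (-1/6)"
  have "?a\<^sup>2 = 4 * n' powr (2/3)"
    using n' by (simp add: power_mult_distrib powr_power)
  moreover have "?b\<^sup>2 = 9 * (n * n' powr (-1/3))"
    using n' assms by (simp add: power_mult_distrib powr_power)
  moreover have "8 * n / sqrt (n' powr (2/3)) = 8 * (n * n' powr (-1/3))"
    using n' by (simp add: powr_half_sqrt[symmetric] powr_powr powr_minus_divide)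
  moreover have "0 \<le> n * n' powr (-1/3)" using assms by simp
  moreover have "0 \<le> ?a * ?b" by simp
  ultimately have "4 * n' powr (2/3) + 8 * n / sqrt (n' powr (2/3)) \<le> (?a + ?b)\<^sup>2"
    unfolding power2_sum by linarith
  then have "sqrt (4 * n' powr (2/3) + 8 * n / sqrt (n' powr (2/3))) \<le> ?a + ?b"
    by (intro real_le_lsqrt) auto
  also have "?a \<le> 2 * (\<alpha> powr (1/3) * n powr (1/3))"
    using powr_mono2[of "1/3" n' "\<alpha> * n"] assms n' by (simp add: powr_mult)
  also have "?b \<le> 3 * n powr (1/2) * (\<beta> * n) powr (-1/6)"
    using powr_mono2'[of "-1/6" "\<beta> * n" n'] assms bn by (intro mult_left_mono) auto
  also have "\<dots> = 3 * \<beta> powr (-1/6) * n powr (1/3)"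
    using powr_add[of n "1/2" "-1/6"] assms by (simp add: powr_mult)
  finally have "sqrt (4 * n' powr (2/3) + 8 * n / sqrt (n' powr (2/3)))
      \<le> 2 * (\<alpha> powr (1/3) * n powr (1/3)) + 3 * \<beta> powr (-1/6) * n powr (1/3)"
    by simp
  also have "\<dots> \<le> 3 * n powr (1/3) * (\<beta> powr (-1/6) + \<alpha> powr (1/3))"
    by (simp add: distrib_left)
  finally show ?thesis .
qed

theorem theorem3p3:
  shows "\<exists>C::real. C > 0 \<and>
    (\<forall>(I::job_instance) (\<alpha>::real) (\<beta>::real) (n'::real) srpt opt.
       valid_instance I \<and> 1 \<le> njobs I \<and>
       1 / real (njobs I) \<le> \<beta> \<and> \<beta> \<le> 1 \<and> 1 \<le> \<alpha> \<and>
       \<beta> * real (njobs I) \<le> n' \<and> n' \<le> \<alpha> * real (njobs I) \<and>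
       srpt_schedule I srpt \<and> optimal I opt \<longrightarrow>
       sqrt (sq_flow I (bal I (n' powr (2/3)) srpt))
         \<le> C * real (njobs I) powr (1/3) * (\<beta> powr (-1/6) + \<alpha> powr (1/3))
             * sqrt (sq_flow I opt))"
proof (intro exI[of _ 3] conjI allI impI)
  fix I :: job_instance and \<alpha> \<beta> n' :: real and srpt opt
  let ?n = "real (njobs I)"
  let ?\<theta> = "n' powr (2/3)"
  let ?c = "4 * ?\<theta> + 8 * ?n / sqrt ?\<theta>"
  assume A: "valid_instance I \<and> 1 \<le> njobs I \<and> 1 / ?n \<le> \<beta> \<and> \<beta> \<le> 1 \<and> 1 \<le> \<alpha> \<and>
       \<beta> * ?n \<le> n' \<and> n' \<le> \<alpha> * ?n \<and> srpt_schedule I srpt \<and> optimal I opt"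
  then have n: "0 < ?n" by simp
  \<comment> \<open>The lower bound on \<beta> yields the threshold of at least 1 that
    \<open>bal_sq_flow_le\<close> needs.\<close>
  then have "1 \<le> \<beta> * ?n" using A pos_divide_le_eq[OF n, of 1 \<beta>] by blast
  then have "1 \<le> n'" using A by linarith
  then have \<theta>: "1 \<le> ?\<theta>" by (simp add: ge_one_powr_ge_zero)
  have \<beta>: "0 < \<beta>" using A n by (meson less_le_trans zero_less_divide_1_iff)
  have "sq_flow I (bal I ?\<theta> srpt) \<le> ?c * sq_flow I opt"
    using A \<theta> by (intro bal_sq_flow_le) (auto simp: optimal_def)
  then have "sqrt (sq_flow I (bal I ?\<theta> srpt)) \<le> sqrt ?c * sqrt (sq_flow I opt)"
    by (metis real_sqrt_le_mono real_sqrt_mult)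
  also have "\<dots> \<le> 3 * ?n powr (1/3) * (\<beta> powr (-1/6) + \<alpha> powr (1/3)) * sqrt (sq_flow I opt)"
    using sqrt_ratio_le[OF n \<beta>, of \<alpha> n'] A
    by (intro mult_right_mono) (auto simp: sq_flow_def sum_nonneg)
  finally show "sqrt (sq_flow I (bal I ?\<theta> srpt))
      \<le> 3 * ?n powr (1/3) * (\<beta> powr (-1/6) + \<alpha> powr (1/3)) * sqrt (sq_flow I opt)" .
qed simp

end
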